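(* For $\alpha>0$, $t>0$, $\beta\in\mathbb{R}$, define $$\varepsilon=\varepsilon(t,\alpha,\beta)=\frac\pi4\left(1-\sqrt{1-\frac{8\pi\alpha t}{(1+2\pi\alpha t)^2+(2\pi\beta t)^2}}\right).$$ Let $g(u)=e^{-\pi|u|^2}$, $u\in\mathbb{R}^d$, and let $G_t(z,w)=\langle\sigma(t,D_x)\pi(z)g,\pi(w)g\rangle$ be the Gabor matrix of the propagator $\sigma(t,D_x)$ of the complex heat equation $\partial_tu=(\alpha+i\beta)\Delta u$. Then, for all $z=(z_1,z_2)$, $w=(w_1,w_2)\in\mathbb{R}^{2d}$, $$|G_t(z,w)|\le\frac{1}{2^{d/2}\left[(1+2\pi\alpha t)^2+(2\pi\beta t)^2\right]^{d/4}}\exp\left(-\frac\varepsilon2(|z_2|^2+|w_2|^2)-\varepsilon|z_1-w_1|^2\right).$$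
   Context: Fourier transform: $\widehat f(\xi)=\int_{\mathbb{R}^d} f(x)e^{-2\pi i x\cdot\xi}dx$. The propagator is the Fourier multiplier $\sigma(t,D_x)f=\mathcal{F}^{-1}(e^{-4\pi^2(\alpha+i\beta)t|\xi|^2}\widehat f(\xi))$. Time-frequency shifts: $\pi(z_1,z_2)f(u)=e^{2\pi iz_2\cdot u}f(u-z_1)$. $\langle\cdot,\cdot\rangle$ is the $L^2(\mathbb{R}^d)$ inner product. *)

theory Defs
  imports "HOL-Analysis.Analysis"
begin

text \<open>
  The space \<open>\<real>\<^sup>d\<close> is \<^typ>\<open>real^'n\<close> with \<open>d = CARD('n)\<close>, and phase space \<open>\<real>\<^sup>2\<^sup>d\<close> is
  \<^typ>\<open>(real^'n) \<times> (real^'n)\<close>. The Fourier transform and its inverse are the absolutely convergent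
  Lebesgue integrals, not their \<open>L\<^sup>2\<close> extensions. This determines the propagator on
  \<open>L\<^sup>1 \<inter> L\<^sup>2\<close> for \<open>\<alpha>, t > 0\<close>: the transform of an integrable function is bounded and the heat
  symbol is integrable, so that both integrals converge.
\<close>

definition fourier :: "(real^'n \<Rightarrow> complex) \<Rightarrow> real^'n \<Rightarrow> complex" where
  "fourier f \<xi> = (LINT x|lborel. f x * exp (- 2 * pi * \<i> * of_real (x \<bullet> \<xi>)))"

definition inverse_fourier :: "(real^'n \<Rightarrow> complex) \<Rightarrow> real^'n \<Rightarrow> complex" where
  "inverse_fourier F x = (LINT \<xi>|lborel. F \<xi> * exp (2 * pi * \<i> * of_real (x \<bullet> \<xi>)))"

definition heat_symbol :: "real \<Rightarrow> real \<Rightarrow> real \<Rightarrow> real^'n \<Rightarrow> complex" where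
  "heat_symbol \<alpha> \<beta> t \<xi> =
     exp (- 4 * (of_real pi)\<^sup>2 * (of_real \<alpha> + \<i> * of_real \<beta>) * of_real t * of_real ((norm \<xi>)\<^sup>2))"

definition heat_propagator ::
    "real \<Rightarrow> real \<Rightarrow> real \<Rightarrow> (real^'n \<Rightarrow> complex) \<Rightarrow> real^'n \<Rightarrow> complex" where
  "heat_propagator \<alpha> \<beta> t f = inverse_fourier (\<lambda>\<xi>. heat_symbol \<alpha> \<beta> t \<xi> * fourier f \<xi>)"

fun tf_shift :: "(real^'n) \<times> (real^'n) \<Rightarrow> (real^'n \<Rightarrow> complex) \<Rightarrow> real^'n \<Rightarrow> complex" where
  "tf_shift (z1, z2) f u = exp (2 * pi * \<i> * of_real (z2 \<bullet> u)) * f (u - z1)"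

definition L2_inner :: "(real^'n \<Rightarrow> complex) \<Rightarrow> (real^'n \<Rightarrow> complex) \<Rightarrow> complex" where
  "L2_inner f h = (LINT u|lborel. f u * cnj (h u))"

definition gaussian :: "real^'n \<Rightarrow> complex" where
  "gaussian u = of_real (exp (- pi * (norm u)\<^sup>2))"

definition gabor_matrix ::
    "real \<Rightarrow> real \<Rightarrow> real \<Rightarrow> (real^'n) \<times> (real^'n) \<Rightarrow> (real^'n) \<times> (real^'n) \<Rightarrow> complex" where
  "gabor_matrix \<alpha> \<beta> t z w =
     L2_inner (heat_propagator \<alpha> \<beta> t (tf_shift z gaussian)) (tf_shift w gaussian)"

definition heat_eps :: "real \<Rightarrow> real \<Rightarrow> real \<Rightarrow> real" where
  "heat_eps t \<alpha> \<beta> =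
     pi / 4 * (1 - sqrt (1 - 8 * pi * \<alpha> * t / ((1 + 2 * pi * \<alpha> * t)\<^sup>2 + (2 * pi * \<beta> * t)\<^sup>2)))"

end

theory Submission
  imports Defs "HOL-Complex_Analysis.Cauchy_Integral_Theorem" "HOL-Probability.Distributions"
    "HOL-Real_Asymp.Real_Asymp"
begin

text \<open>
  By Parseval's identity the Gabor matrix is \<open>\<integral> \<sigma>(\<xi>) F(\<xi>) cnj (H(\<xi>)) d\<xi>\<close>, where \<open>\<sigma>\<close> is the heat symbol
  and \<open>F\<close>, \<open>H\<close> are the Fourier transforms of the two shifted Gaussians. These are again shifted
  Gaussians, so the integrand is a constant times the exponential of
  \<open>- a |\<xi>|\<^sup>2 + p' \<bullet> \<xi> + \<i> q' \<bullet> \<xi>\<close>, with \<open>a = 2 \<pi> (A + \<i> B)\<close>, \<open>A = 1 + 2 \<pi> \<alpha> t\<close> and \<open>B = 2 \<pi> \<beta> t\<close>. The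
  complex Gaussian integral (\<open>integral_gaussian\<close>) then gives the modulus of the Gabor matrix exactly
  (\<open>cmod_gabor_matrix_eq\<close>). Its prefactor \<open>|\<pi> / a|\<^bsup>d/2\<^esup>\<close> is the one claimed, so that only the exponents
  have to be compared.

  Put \<open>D = A\<^sup>2 + B\<^sup>2\<close>, \<open>p = z2 + w2\<close>, \<open>q = z1 - w1\<close>, \<open>m = z2 - w2\<close> and \<open>e = \<epsilon> / \<pi>\<close>. By the parallelogram
  law the claimed exponent exceeds the exact one by \<open>\<pi> / 2\<close> times
  \<open>(1 - e/2 - A/D) |p|\<^sup>2 + (A/D - 2 e) |q|\<^sup>2 + 2 (B/D) p \<bullet> q + (1 - e/2) |m|\<^sup>2\<close>.
  By definition \<open>e\<close> is the smaller root of \<open>2 e - 4 e\<^sup>2 = (A - 1) / D\<close>, and with this equation the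
  determinant of the form in \<open>p\<close> and \<open>q\<close> collapses to \<open>3/2 e (A/D - 2 e)\<close>. It is nonnegative because
  \<open>A/D - 2 e = 1/D - 4 e\<^sup>2\<close> and \<open>2 e \<le> 1 / sqrt D\<close> (\<open>heat_eps_root_bounds\<close>).

  The one-dimensional complex Gaussian integral is obtained from the real one by moving the line of
  integration: a primitive of the entire function \<open>exp (- z\<^sup>2)\<close> has asymptotically the same increments
  along every line whose direction lies in the sector \<open>|Im z| < Re z\<close>.
\<close>

section \<open>Complex Gaussian integrals on the line\<close>

text \<open>
  For \<open>\<rho> \<ge> 0\<close> the set \<open>Re z - |Im z| \<ge> \<rho>\<close> is convex, and on it \<open>Re (z\<^sup>2) \<ge> \<rho>\<^sup>2\<close>, so \<open>\<Phi>\<close> is Lipschitz there with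
  constant \<open>exp (- \<rho>\<^sup>2)\<close>. Both \<open>R\<close> and \<open>s R - c\<close> lie in such a set with \<open>\<rho>\<close> growing linearly in \<open>R\<close>, while
  their distance grows only linearly.
\<close>

lemma gaussian_primitive_ray_limit:
  fixes \<Phi> :: "complex \<Rightarrow> complex" and s c :: complex
  assumes deriv: "\<And>z. (\<Phi> has_field_derivative exp (- z\<^sup>2)) (at z)"
    and s: "\<bar>Im s\<bar> < Re s"
  shows "((\<lambda>R::real. \<Phi> (s * of_real R - c) - \<Phi> (of_real R)) \<longlongrightarrow> 0) at_top"
proof -
  define \<delta> where "\<delta> = min 1 (Re s - \<bar>Im s\<bar>)"
  define m where "m = \<bar>Re c\<bar> + \<bar>Im c\<bar>"
  have \<delta>: "0 < \<delta>" "\<delta> \<le> 1" "\<delta> \<le> Re s - \<bar>Im s\<bar>"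
    using s by (auto simp: \<delta>_def)
  have bound: "norm (\<Phi> (s * of_real R - c) - \<Phi> (of_real R))
      \<le> exp (- (\<delta> * R - m)\<^sup>2) * (cmod (s - 1) * R + cmod c)"
    if R: "R \<ge> m / \<delta>" for R
  proof -
    define \<rho> where "\<rho> = \<delta> * R - m"
    define S where "S = {z. \<bar>Im z\<bar> + \<rho> \<le> Re z}"
    have "m \<ge> 0" by (simp add: m_def)
    then have "R \<ge> 0" using R \<delta>(1) by (smt (verit) divide_nonneg_pos)
    have "\<rho> \<ge> 0" using R \<delta>(1) by (simp add: \<rho>_def field_simps)
    have "S = {z. (\<i> - 1) \<bullet> z \<le> - \<rho>} \<inter> {z. (- \<i> - 1) \<bullet> z \<le> - \<rho>}"
      by (auto simp: S_def inner_complex_def)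
    then have "convex S"
      by (simp only: convex_Int convex_halfspace_le)
    moreover have "norm (exp (- z\<^sup>2)) \<le> exp (- \<rho>\<^sup>2)" if "z \<in> S" for z
    proof -
      have "\<rho>\<^sup>2 \<le> (Re z - \<bar>Im z\<bar>)\<^sup>2"
        using that \<open>\<rho> \<ge> 0\<close> by (intro power_mono) (auto simp: S_def)
      also have "\<dots> \<le> (Re z - \<bar>Im z\<bar>) * (Re z + \<bar>Im z\<bar>)"
        unfolding power2_eq_square
        using that \<open>\<rho> \<ge> 0\<close> by (intro mult_left_mono) (auto simp: S_def)
      also have "\<dots> = Re (z\<^sup>2)"
        by (simp add: power2_eq_square algebra_simps)
      finally show ?thesis by simp
    qed
    moreover have "s * of_real R - c \<in> S"
    proof -
      have "\<delta> * R \<le> (Re s - \<bar>Im s\<bar>) * R"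
        using \<delta> \<open>R \<ge> 0\<close> by (intro mult_right_mono)
      moreover have "\<bar>Im s * R - Im c\<bar> \<le> \<bar>Im s\<bar> * R + \<bar>Im c\<bar>"
        using abs_triangle_ineq4[of "Im s * R" "Im c"] \<open>R \<ge> 0\<close> by (simp add: abs_mult)
      ultimately show ?thesis
        by (simp add: S_def \<rho>_def m_def algebra_simps)
    qed
    moreover have "of_real R \<in> S"
      using \<delta> \<open>R \<ge> 0\<close> \<open>m \<ge> 0\<close> mult_right_mono[of \<delta> 1 R] by (simp add: S_def \<rho>_def)
    ultimately have "norm (\<Phi> (s * of_real R - c) - \<Phi> (of_real R))
        \<le> exp (- \<rho>\<^sup>2) * norm (s * of_real R - c - of_real R)"
      by (intro field_differentiable_bound[of S \<Phi> "\<lambda>z. exp (- z\<^sup>2)"])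
         (auto intro: has_field_derivative_at_within deriv)
    also have "\<dots> \<le> exp (- \<rho>\<^sup>2) * (cmod (s - 1) * R + cmod c)"
    proof (intro mult_left_mono)
      have "s * of_real R - c - of_real R = (s - 1) * of_real R - c"
        by (simp add: algebra_simps)
      then show "norm (s * of_real R - c - of_real R) \<le> cmod (s - 1) * R + cmod c"
        using norm_triangle_ineq4[of "(s - 1) * of_real R" c] \<open>R \<ge> 0\<close>
        by (simp only: norm_mult norm_of_real abs_of_nonneg)
    qed auto
    finally show ?thesis by (simp add: \<rho>_def)
  qed
  show ?thesis
  proof (rule Lim_null_comparison)
    show "\<forall>\<^sub>F R in at_top. norm (\<Phi> (s * of_real R - c) - \<Phi> (of_real R))
        \<le> exp (- (\<delta> * R - m)\<^sup>2) * (cmod (s - 1) * R + cmod c)"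
      using bound by (auto simp: eventually_at_top_linorder)
    show "((\<lambda>R. exp (- (\<delta> * R - m)\<^sup>2) * (cmod (s - 1) * R + cmod c)) \<longlongrightarrow> 0) at_top"
      using \<delta>(1) by real_asymp
  qed
qed

lemma integrable_real_gaussian:
  fixes a b :: real
  assumes "a > 0"
  shows "integrable lborel (\<lambda>x. exp (- (a * x\<^sup>2) + b * x))"
proof -
  have "exp (- (a * x\<^sup>2) + b * x) = (exp (b\<^sup>2 / (4 * a)) * sqrt (pi / a)) * normal_density (b / (2 * a)) (1 / sqrt (2 * a)) x" for x
    using assms
    by (simp add: normal_density_def power_divide exp_add[symmetric])
       (simp add: power2_eq_square field_simps)
  then show ?thesis
    using assms by (simp add: integrable_normal_density)
qed

lemma csqrt_in_open_sector:
  assumes "Re a > 0"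
  shows "\<bar>Im (csqrt a)\<bar> < Re (csqrt a)"
proof -
  have "Re a = (Re (csqrt a))\<^sup>2 - (Im (csqrt a))\<^sup>2"
    by (metis Re_power2 power2_csqrt)
  then show ?thesis
    using assms Re_csqrt[of a] by (metis abs_le_square_iff abs_of_nonneg diff_gt_0_iff_gt not_le)
qed

lemma integrable_complex_gaussian:
  fixes a b :: complex
  assumes "Re a > 0"
  shows "integrable lborel (\<lambda>x::real. exp (- (a * of_real (x\<^sup>2)) + b * of_real x))"
  by (rule Bochner_Integration.integrable_bound[OF integrable_real_gaussian[OF assms, of "Re b"]])
     (auto simp: borel_measurable_exp)

text \<open>
  Completing the square, \<open>b x - a x\<^sup>2 = b\<^sup>2 / (4 a) - (s x - c)\<^sup>2\<close> with \<open>s\<^sup>2 = a\<close> and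
  \<open>c = b / (2 s)\<close>, turns the truncated integral into an increment of \<open>\<Phi>\<close> along the complex
  line \<open>s x - c\<close>.
\<close>

lemma truncated_complex_gaussian_tendsto:
  fixes \<Phi> :: "complex \<Rightarrow> complex" and a b s c :: complex
  assumes deriv: "\<And>z. (\<Phi> has_field_derivative exp (- z\<^sup>2)) (at z)"
    and a: "Re a > 0"
  defines "s \<equiv> csqrt a" and "c \<equiv> b / (2 * csqrt a)"
  shows "(\<lambda>n. (1 / s * exp (b\<^sup>2 / (4 * a)))
            * (\<Phi> (s * of_real (real n) - c) - \<Phi> (s * of_real (- real n) - c)))
       \<longlonglongrightarrow> (LINT x|lborel. exp (- (a * of_real (x\<^sup>2)) + b * of_real x))"
proof -
  have s: "s\<^sup>2 = a" "s \<noteq> 0" using a by (auto simp: s_def)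
  have c: "c = b / (2 * s)" by (simp add: c_def s_def)
  let ?f = "\<lambda>x::real. exp (- (a * of_real (x\<^sup>2)) + b * of_real x)"
  let ?F = "\<lambda>x::real. (1 / s * exp (b\<^sup>2 / (4 * a))) * \<Phi> (s * of_real x - c)"
  have square: "- (a * of_real (x\<^sup>2)) + b * of_real x = b\<^sup>2 / (4 * a) - (s * of_real x - c)\<^sup>2" for x
    using s(2) unfolding c s(1)[symmetric]
    by (simp add: power2_eq_square field_simps)
  have "(LINT x|lborel. indicator {- real n..real n} x *\<^sub>R ?f x) = ?F (real n) - ?F (- real n)" for n
  proof (rule integral_FTC_Icc)
    fix x :: real
    have "((\<lambda>z. \<Phi> (s * z - c)) has_field_derivative exp (- (s * of_real x - c)\<^sup>2) * s) (at (of_real x))"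
      by (rule DERIV_chain2[OF deriv]) (auto intro!: derivative_eq_intros)
    then have "((\<lambda>z. (1 / s * exp (b\<^sup>2 / (4 * a))) * \<Phi> (s * z - c)) has_field_derivative ?f x) (at (of_real x))"
      unfolding square exp_diff
      by (rule DERIV_cmult[THEN DERIV_cong]) (use s(2) in \<open>simp add: exp_minus field_simps\<close>)
    then show "(?F has_vector_derivative ?f x) (at x within {- real n..real n})"
      by (rule has_vector_derivative_at_within[OF has_vector_derivative_real_field])
  next
    show "continuous_on {- real n..real n} ?f" by (intro continuous_intros)
  qed auto
  moreover have "(\<lambda>n. LINT x|lborel. indicator {- real n..real n} x *\<^sub>R ?f x) \<longlonglongrightarrow> (LINT x|lborel. ?f x)"
  proof (rule integral_dominated_convergence[where w = "\<lambda>x. norm (?f x)"])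
    show "AE x in lborel. (\<lambda>n. indicator {- real n..real n} x *\<^sub>R ?f x) \<longlonglongrightarrow> ?f x"
    proof (intro AE_I2 tendsto_eventually)
      fix x :: real
      show "\<forall>\<^sub>F n in sequentially. indicator {- real n..real n} x *\<^sub>R ?f x = ?f x"
        using eventually_ge_at_top[of "nat \<lceil>\<bar>x\<bar>\<rceil>"]
        by eventually_elim (auto simp: indicator_def; linarith)
    qed
    show "integrable lborel (\<lambda>x. norm (?f x))"
      by (rule integrable_norm[OF integrable_complex_gaussian[OF a]])
  qed (auto split: split_indicator)
  ultimately show ?thesis
    by (simp add: right_diff_distrib)
qed

text \<open>
  Any primitive \<open>\<Phi>\<close> of the entire function \<open>exp (- z\<^sup>2)\<close> compares the general integral with the
  real one. Both are limits of increments of \<open>\<Phi>\<close>, the first along the line \<open>s x - c\<close> and the second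
  along the real axis, and the endpoint corrections vanish by \<open>gaussian_primitive_ray_limit\<close>.
\<close>

lemma integral_complex_gaussian:
  fixes a b :: complex
  assumes a: "Re a > 0"
  shows "(LINT x|lborel. exp (- (a * of_real (x\<^sup>2)) + b * of_real x))
        = of_real (sqrt pi) / csqrt a * exp (b\<^sup>2 / (4 * a))"
proof -
  obtain \<Phi> :: "complex \<Rightarrow> complex" where \<Phi>: "\<And>z. (\<Phi> has_field_derivative exp (- z\<^sup>2)) (at z)"
  proof -
    have "(\<lambda>z::complex. exp (- z\<^sup>2)) holomorphic_on UNIV"
      by (intro holomorphic_intros)
    then show ?thesis
      by (rule holomorphic_convex_primitive'[OF convex_UNIV open_UNIV]) (use that in auto)
  qed
  define s c where "s = csqrt a" and "c = b / (2 * csqrt a)"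
  have s: "\<bar>Im s\<bar> < Re s" using csqrt_in_open_sector[OF a] by (simp add: s_def)
  have real_case: "(LINT x|lborel. exp (- (1 * of_real (x\<^sup>2)) + 0 * of_real x)) = complex_of_real (sqrt pi)"
  proof -
    have eq: "sqrt pi * normal_density 0 (1 / sqrt 2) x = exp (- x\<^sup>2)" for x
      by (simp add: normal_density_def power_divide real_sqrt_divide)
    have "complex_of_real (LINT x|lborel. sqrt pi * normal_density 0 (1 / sqrt 2) x) = of_real (sqrt pi)"
      by (simp add: integral_normal_density)
    then show ?thesis
      unfolding eq integral_complex_of_real[symmetric] by (simp add: exp_of_real[symmetric])
  qed
  have real_axis: "(\<lambda>n. \<Phi> (of_real (real n)) - \<Phi> (of_real (- real n))) \<longlonglongrightarrow> of_real (sqrt pi)"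
    using truncated_complex_gaussian_tendsto[OF \<Phi>, of 1 0] unfolding real_case by simp
  have upper: "(\<lambda>n. \<Phi> (s * of_real (real n) - c) - \<Phi> (of_real (real n))) \<longlonglongrightarrow> 0"
    by (rule filterlim_compose[OF gaussian_primitive_ray_limit[OF \<Phi> s] filterlim_real_sequentially])
  \<comment> \<open>The lower endpoint is the upper endpoint of the reflected primitive \<open>\<lambda>z. - \<Phi> (- z)\<close>.\<close>
  have "((\<lambda>z. - \<Phi> (- z)) has_field_derivative exp (- z\<^sup>2)) (at z)" for z
    using \<Phi>[of "- z"] by (auto intro!: derivative_eq_intros DERIV_chain2[of \<Phi>])
  from gaussian_primitive_ray_limit[OF this s, of "- c"]
  have lower: "(\<lambda>n. - \<Phi> (- (s * of_real (real n) - - c)) - - \<Phi> (- of_real (real n))) \<longlonglongrightarrow> 0"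
    by (rule filterlim_compose[OF _ filterlim_real_sequentially])
  have "(\<lambda>n. (\<Phi> (s * of_real (real n) - c) - \<Phi> (of_real (real n)))
      + (\<Phi> (of_real (real n)) - \<Phi> (of_real (- real n)))
      + (- \<Phi> (- (s * of_real (real n) - - c)) - - \<Phi> (- of_real (real n)))) \<longlonglongrightarrow> 0 + of_real (sqrt pi) + 0"
    by (intro tendsto_add upper real_axis lower)
  moreover have "- (s * of_real (real n) - - c) = s * of_real (- real n) - c" for n
    by simp
  ultimately have "(\<lambda>n. \<Phi> (s * of_real (real n) - c) - \<Phi> (s * of_real (- real n) - c)) \<longlonglongrightarrow> of_real (sqrt pi)"
    by simp
  then have "(\<lambda>n. (1 / s * exp (b\<^sup>2 / (4 * a))) * (\<Phi> (s * of_real (real n) - c) - \<Phi> (s * of_real (- real n) - c)))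
      \<longlonglongrightarrow> (1 / s * exp (b\<^sup>2 / (4 * a))) * of_real (sqrt pi)"
    by (intro tendsto_mult_left)
  from LIMSEQ_unique[OF truncated_complex_gaussian_tendsto[OF \<Phi> a, of b, folded s_def c_def] this]
  show ?thesis by (simp add: s_def)
qed

section \<open>Complex Gaussian integrals in Euclidean space\<close>

lemma
  fixes f :: "'a::euclidean_space \<Rightarrow> real \<Rightarrow> complex"
  assumes int: "\<And>b. b \<in> Basis \<Longrightarrow> integrable lborel (f b)"
  shows integrable_lborel_prod: "integrable lborel (\<lambda>x. \<Prod>b\<in>Basis. f b (x \<bullet> b))"
    and integral_lborel_prod:
      "(LINT x|lborel. (\<Prod>b\<in>Basis. f b (x \<bullet> b))) = (\<Prod>b\<in>Basis. LINT y|lborel. f b y)"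
proof -
  interpret product_sigma_finite "\<lambda>_::'a. lborel :: real measure"
    by standard
  have [measurable]: "f b \<in> borel_measurable borel" if "b \<in> Basis" for b
    using int[OF that] by (simp add: borel_measurable_integrable)
  let ?assemble = "\<lambda>y. \<Sum>b\<in>Basis. y b *\<^sub>R (b::'a)"
  have assemble: "?assemble \<in> measurable (\<Pi>\<^sub>M b\<in>Basis. lborel) borel"
    by measurable
  have prod_measurable: "(\<lambda>x. \<Prod>b\<in>Basis. f b (x \<bullet> b)) \<in> borel_measurable borel"
    by (intro borel_measurable_prod) measurable
  have coord: "(\<Prod>b\<in>Basis. f b (?assemble y \<bullet> b)) = (\<Prod>b\<in>Basis. f b (y b))" for y
    by (intro prod.cong refl) simp
  have "integrable (\<Pi>\<^sub>M b\<in>Basis. lborel) (\<lambda>y. \<Prod>b\<in>Basis. f b (y b))"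
    by (rule product_integrable_prod) (use int in auto)
  then have "integrable (distr (\<Pi>\<^sub>M b\<in>Basis. lborel) borel ?assemble) (\<lambda>x. \<Prod>b\<in>Basis. f b (x \<bullet> b))"
    by (simp only: integrable_distr_eq[OF assemble prod_measurable] coord)
  then show "integrable lborel (\<lambda>x. \<Prod>b\<in>Basis. f b (x \<bullet> b))"
    by (simp only: lborel_eq[where 'a='a])
  have "(LINT x|lborel. (\<Prod>b\<in>Basis. f b (x \<bullet> b)))
      = (LINT x|distr (\<Pi>\<^sub>M b\<in>Basis. lborel) borel ?assemble. (\<Prod>b\<in>Basis. f b (x \<bullet> b)))"
    by (simp only: lborel_eq[where 'a='a])
  also have "\<dots> = (LINT y|(\<Pi>\<^sub>M b\<in>Basis. lborel). (\<Prod>b\<in>Basis. f b (y b)))"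
    by (simp only: integral_distr[OF assemble prod_measurable] coord)
  also have "\<dots> = (\<Prod>b\<in>Basis. LINT y|lborel. f b y)"
    by (rule product_integral_prod) (use int in auto)
  finally show "(LINT x|lborel. (\<Prod>b\<in>Basis. f b (x \<bullet> b))) = (\<Prod>b\<in>Basis. LINT y|lborel. f b y)" .
qed

text \<open>
  In coordinates the integrand is a product of one-dimensional Gaussians with complex linear
  coefficients \<open>u\<^sub>b + \<i> v\<^sub>b\<close>, whose squares add up to \<open>|u|\<^sup>2 - |v|\<^sup>2 + 2 \<i> u \<bullet> v\<close>.
\<close>

lemma
  fixes a :: complex and u v :: "'a::euclidean_space"
  assumes a: "Re a > 0"
  shows integrable_gaussian:
      "integrable lborel (\<lambda>x. exp (- (a * of_real ((norm x)\<^sup>2)) + of_real (x \<bullet> u) + \<i> * of_real (x \<bullet> v)))"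
    and integral_gaussian:
      "(LINT x|lborel. exp (- (a * of_real ((norm x)\<^sup>2)) + of_real (x \<bullet> u) + \<i> * of_real (x \<bullet> v)))
       = (of_real (sqrt pi) / csqrt a) ^ DIM('a)
         * exp ((of_real ((norm u)\<^sup>2 - (norm v)\<^sup>2) + 2 * \<i> * of_real (u \<bullet> v)) / (4 * a))"
proof -
  define c where "c b = of_real (u \<bullet> b) + \<i> * of_real (v \<bullet> b)" for b
  have factor: "exp (- (a * of_real ((norm x)\<^sup>2)) + of_real (x \<bullet> u) + \<i> * of_real (x \<bullet> v))
      = (\<Prod>b\<in>Basis. exp (- (a * of_real ((x \<bullet> b)\<^sup>2)) + c b * of_real (x \<bullet> b)))" for x
    unfolding exp_sum[OF finite_Basis, symmetric] power2_norm_eq_inner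
      euclidean_inner[of x x] euclidean_inner[of x u] euclidean_inner[of x v] c_def
    by (simp add: sum.distrib sum_subtractf sum_distrib_left power2_eq_square algebra_simps)
  have int: "integrable lborel (\<lambda>y::real. exp (- (a * of_real (y\<^sup>2)) + c b * of_real y))" for b
    by (rule integrable_complex_gaussian[OF a])
  show "integrable lborel (\<lambda>x. exp (- (a * of_real ((norm x)\<^sup>2)) + of_real (x \<bullet> u) + \<i> * of_real (x \<bullet> v)))"
    unfolding factor by (rule integrable_lborel_prod[OF int])
  have "(LINT x|lborel. exp (- (a * of_real ((norm x)\<^sup>2)) + of_real (x \<bullet> u) + \<i> * of_real (x \<bullet> v)))
      = (\<Prod>b\<in>(Basis::'a set). of_real (sqrt pi) / csqrt a * exp ((c b)\<^sup>2 / (4 * a)))"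
    unfolding factor integral_lborel_prod[OF int] integral_complex_gaussian[OF a] ..
  also have "\<dots> = (of_real (sqrt pi) / csqrt a) ^ DIM('a) * exp ((\<Sum>b\<in>(Basis::'a set). (c b)\<^sup>2) / (4 * a))"
    unfolding prod.distrib prod_constant sum_divide_distrib exp_sum[OF finite_Basis] ..
  also have "(\<Sum>b\<in>(Basis::'a set). (c b)\<^sup>2) = of_real ((norm u)\<^sup>2 - (norm v)\<^sup>2) + 2 * \<i> * of_real (u \<bullet> v)"
  proof -
    have "(c b)\<^sup>2 = of_real ((u \<bullet> b) * (u \<bullet> b)) - of_real ((v \<bullet> b) * (v \<bullet> b))
        + 2 * \<i> * of_real ((u \<bullet> b) * (v \<bullet> b))" for b
      by (simp add: c_def power2_eq_square algebra_simps)
    then show ?thesis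
      unfolding power2_norm_eq_inner euclidean_inner[of u u] euclidean_inner[of v v] euclidean_inner[of u v]
      by (simp add: sum.distrib sum_subtractf sum_distrib_left)
  qed
  finally show "(LINT x|lborel. exp (- (a * of_real ((norm x)\<^sup>2)) + of_real (x \<bullet> u) + \<i> * of_real (x \<bullet> v)))
       = (of_real (sqrt pi) / csqrt a) ^ DIM('a)
         * exp ((of_real ((norm u)\<^sup>2 - (norm v)\<^sup>2) + 2 * \<i> * of_real (u \<bullet> v)) / (4 * a))" .
qed

section \<open>The Gabor matrix as a Gaussian integral\<close>

lemma tf_shift_gaussian_eq:
  "tf_shift (z1, z2) gaussian u
     = of_real (exp (- pi * (norm z1)\<^sup>2))
       * exp (- (of_real pi * of_real ((norm u)\<^sup>2)) + of_real (u \<bullet> ((2 * pi) *\<^sub>R z1)) + \<i> * of_real (u \<bullet> ((2 * pi) *\<^sub>R z2)))"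
  by (simp add: gaussian_def power2_norm_eq_inner inner_diff_left inner_diff_right inner_commute
        exp_of_real[symmetric] exp_add[symmetric] algebra_simps)

lemma integrable_tf_shift_gaussian: "integrable lborel (tf_shift z gaussian)"
proof -
  obtain z1 z2 where z: "z = (z1, z2)" by fastforce
  show ?thesis
    unfolding z by (subst tf_shift_gaussian_eq[abs_def]) (intro integrable_mult_right integrable_gaussian; simp)
qed

lemma fourier_tf_shift_gaussian:
  fixes z1 z2 \<xi> :: "real^'n"
  shows "fourier (tf_shift (z1, z2) gaussian) \<xi>
     = exp (of_real (- pi * (norm (\<xi> - z2))\<^sup>2) + \<i> * of_real (2 * pi * (z1 \<bullet> (z2 - \<xi>))))"
proof -
  have "fourier (tf_shift (z1, z2) gaussian) \<xi>
     = (LINT u|lborel. of_real (exp (- pi * (norm z1)\<^sup>2))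
       * exp (- (of_real pi * of_real ((norm u)\<^sup>2)) + of_real (u \<bullet> ((2 * pi) *\<^sub>R z1)) + \<i> * of_real (u \<bullet> ((2 * pi) *\<^sub>R (z2 - \<xi>)))))"
    unfolding fourier_def tf_shift_gaussian_eq
    by (simp add: mult.assoc exp_add[symmetric] inner_diff_right algebra_simps)
  also have "\<dots> = of_real (exp (- pi * (norm z1)\<^sup>2))
      * exp ((of_real ((norm ((2 * pi) *\<^sub>R z1))\<^sup>2 - (norm ((2 * pi) *\<^sub>R (z2 - \<xi>)))\<^sup>2)
          + 2 * \<i> * of_real (((2 * pi) *\<^sub>R z1) \<bullet> ((2 * pi) *\<^sub>R (z2 - \<xi>)))) / (4 * of_real pi))"
    unfolding integral_mult_right_zero by (subst integral_gaussian) simp_all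
  also have "\<dots> = exp (of_real (- pi * (norm (\<xi> - z2))\<^sup>2) + \<i> * of_real (2 * pi * (z1 \<bullet> (z2 - \<xi>))))"
  proof -
    define M N I where "M = (norm z1)\<^sup>2" and "N = (norm (\<xi> - z2))\<^sup>2" and "I = z1 \<bullet> (z2 - \<xi>)"
    have scaled: "(norm ((2 * pi) *\<^sub>R z1))\<^sup>2 = 4 * pi\<^sup>2 * M" "(norm ((2 * pi) *\<^sub>R (z2 - \<xi>)))\<^sup>2 = 4 * pi\<^sup>2 * N"
      "((2 * pi) *\<^sub>R z1) \<bullet> ((2 * pi) *\<^sub>R (z2 - \<xi>)) = 4 * pi\<^sup>2 * I"
      by (simp_all add: M_def N_def I_def power_mult_distrib norm_minus_commute[of \<xi>])
         (simp add: power2_eq_square)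
    have "complex_of_real (- pi * M) + (of_real (4 * pi\<^sup>2 * M - 4 * pi\<^sup>2 * N) + 2 * \<i> * of_real (4 * pi\<^sup>2 * I)) / (4 * of_real pi)
        = of_real (- pi * N) + \<i> * of_real (2 * pi * I)"
      by (simp add: complex_eq_iff field_simps power2_eq_square)
    then show ?thesis
      unfolding scaled M_def[symmetric] N_def[symmetric] I_def[symmetric] exp_of_real[symmetric] exp_add[symmetric]
      by (rule arg_cong)
  qed
  finally show ?thesis .
qed

text \<open>
  This form of Parseval's identity is Fubini's theorem for the kernel
  \<open>F \<xi> * exp (2 \<pi> \<i> x \<bullet> \<xi>) * cnj (h x)\<close>, which is integrable on the product because the exponential has
  modulus one.
\<close>

lemma L2_inner_inverse_fourier:
  fixes F h :: "real^'n \<Rightarrow> complex"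
  assumes F: "integrable lborel F" and h: "integrable lborel h"
  shows "L2_inner (inverse_fourier F) h = (LINT \<xi>|lborel. F \<xi> * cnj (fourier h \<xi>))"
proof -
  let ?K = "\<lambda>\<xi> x :: real^'n. F \<xi> * exp (2 * pi * \<i> * of_real (x \<bullet> \<xi>)) * cnj (h x)"
  have [measurable]: "F \<in> borel_measurable borel" "h \<in> borel_measurable borel"
    using F h by (auto dest: borel_measurable_integrable)
  have [measurable]: "cnj \<in> borel_measurable borel"
    by (intro borel_measurable_continuous_onI continuous_intros)
  have kernel_int: "integrable (lborel \<Otimes>\<^sub>M lborel) (\<lambda>(x, \<xi>). ?K \<xi> x)"
  proof (rule lborel_pair.Fubini_integrable)
    show "(\<lambda>(x, \<xi>). ?K \<xi> x) \<in> borel_measurable (lborel \<Otimes>\<^sub>M lborel)" by measurable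
    show "integrable lborel (\<lambda>x. LINT \<xi>|lborel. norm (case (x, \<xi>) of (x, \<xi>) \<Rightarrow> ?K \<xi> x))"
      using h by (simp add: norm_mult)
    show "AE x in lborel. integrable lborel (\<lambda>\<xi>. case (x, \<xi>) of (x, \<xi>) \<Rightarrow> ?K \<xi> x)"
    proof (intro AE_I2)
      fix x :: "real^'n"
      show "integrable lborel (\<lambda>\<xi>. case (x, \<xi>) of (x, \<xi>) \<Rightarrow> ?K \<xi> x)"
        by (rule Bochner_Integration.integrable_bound[OF integrable_mult_left[OF F, of "h x"]])
           (auto simp: norm_mult)
    qed
  qed
  have "L2_inner (inverse_fourier F) h = (LINT x|lborel. LINT \<xi>|lborel. ?K \<xi> x)"
    by (simp add: L2_inner_def inverse_fourier_def)
  also have "\<dots> = (LINT \<xi>|lborel. LINT x|lborel. ?K \<xi> x)"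
    by (rule lborel_pair.Fubini_integral[OF kernel_int, symmetric])
  also have "\<dots> = (LINT \<xi>|lborel. F \<xi> * cnj (fourier h \<xi>))"
  proof -
    have "cnj (fourier h \<xi>) = (LINT x|lborel. exp (2 * pi * \<i> * of_real (x \<bullet> \<xi>)) * cnj (h x))" for \<xi>
      unfolding fourier_def Bochner_Integration.integral_cnj[symmetric]
      by (simp add: exp_cnj mult.commute)
    then show ?thesis by (simp only: mult.assoc integral_mult_right_zero)
  qed
  finally show ?thesis .
qed

lemma gabor_matrix_eq:
  fixes \<alpha> \<beta> t :: real and z1 z2 w1 w2 :: "real^'n"
  assumes "\<alpha> > 0" and "t > 0"
  defines "a \<equiv> 2 * of_real pi * Complex (1 + 2 * pi * \<alpha> * t) (2 * pi * \<beta> * t)"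
  defines "p \<equiv> (2 * pi) *\<^sub>R (z2 + w2)" and "q \<equiv> (2 * pi) *\<^sub>R (w1 - z1)"
  shows "gabor_matrix \<alpha> \<beta> t (z1, z2) (w1, w2)
    = exp (of_real (- pi * ((norm z2)\<^sup>2 + (norm w2)\<^sup>2)) + \<i> * of_real (2 * pi * (z1 \<bullet> z2 - w1 \<bullet> w2)))
      * ((of_real (sqrt pi) / csqrt a) ^ CARD('n)
         * exp ((of_real ((norm p)\<^sup>2 - (norm q)\<^sup>2) + 2 * \<i> * of_real (p \<bullet> q)) / (4 * a)))"
proof -
  have Re_a: "Re a > 0" using assms(1,2) by (simp add: a_def add_pos_pos)
  define m where "m = 4 * (of_real pi)\<^sup>2 * (of_real \<alpha> + \<i> * of_real \<beta>) * of_real t"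
  have m_a: "m + 2 * of_real pi = a"
    by (simp add: m_def a_def complex_eq_iff power2_eq_square algebra_simps)
  have Re_m: "Re (m + of_real pi) > 0"
    using assms(1,2) by (simp add: m_def add_nonneg_pos)
  \<comment> \<open>Each of the two transformed Gaussians adds \<open>\<pi>\<close> to the heat exponent \<open>m\<close>. The first alone already
      makes the function to be inverted integrable; with both the coefficient is \<open>a\<close>.\<close>
  have symbol_fourier: "heat_symbol \<alpha> \<beta> t \<xi> * fourier (tf_shift (z1, z2) gaussian) \<xi>
     = exp (of_real (- pi * (norm z2)\<^sup>2) + \<i> * of_real (2 * pi * (z1 \<bullet> z2)))
       * exp (- ((m + of_real pi) * of_real ((norm \<xi>)\<^sup>2)) + of_real (\<xi> \<bullet> ((2 * pi) *\<^sub>R z2))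
           + \<i> * of_real (\<xi> \<bullet> (- (2 * pi) *\<^sub>R z1)))" for \<xi>
    unfolding fourier_tf_shift_gaussian heat_symbol_def exp_add[symmetric]
    by (rule arg_cong[where f=exp])
       (simp add: m_def power2_norm_eq_inner inner_diff_left inner_diff_right inner_commute algebra_simps)
  have F: "integrable lborel (\<lambda>\<xi>. heat_symbol \<alpha> \<beta> t \<xi> * fourier (tf_shift (z1, z2) gaussian) \<xi>)"
    unfolding symbol_fourier by (intro integrable_mult_right integrable_gaussian Re_m)
  have "gabor_matrix \<alpha> \<beta> t (z1, z2) (w1, w2)
     = (LINT \<xi>|lborel. heat_symbol \<alpha> \<beta> t \<xi> * fourier (tf_shift (z1, z2) gaussian) \<xi>
          * cnj (fourier (tf_shift (w1, w2) gaussian) \<xi>))"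
    unfolding gabor_matrix_def heat_propagator_def
    by (rule L2_inner_inverse_fourier[OF F integrable_tf_shift_gaussian])
  also have "\<dots> = (LINT \<xi>|lborel.
      exp (of_real (- pi * ((norm z2)\<^sup>2 + (norm w2)\<^sup>2)) + \<i> * of_real (2 * pi * (z1 \<bullet> z2 - w1 \<bullet> w2)))
      * exp (- (a * of_real ((norm \<xi>)\<^sup>2)) + of_real (\<xi> \<bullet> p) + \<i> * of_real (\<xi> \<bullet> q)))"
  proof (rule arg_cong[where f = "integral\<^sup>L lborel"], rule ext)
    fix \<xi> :: "real^'n"
    show "heat_symbol \<alpha> \<beta> t \<xi> * fourier (tf_shift (z1, z2) gaussian) \<xi> * cnj (fourier (tf_shift (w1, w2) gaussian) \<xi>)
      = exp (of_real (- pi * ((norm z2)\<^sup>2 + (norm w2)\<^sup>2)) + \<i> * of_real (2 * pi * (z1 \<bullet> z2 - w1 \<bullet> w2)))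
      * exp (- (a * of_real ((norm \<xi>)\<^sup>2)) + of_real (\<xi> \<bullet> p) + \<i> * of_real (\<xi> \<bullet> q))"
      unfolding symbol_fourier
      unfolding fourier_tf_shift_gaussian exp_cnj exp_add[symmetric]
      by (rule arg_cong[where f=exp])
         (simp add: m_a[symmetric] p_def q_def power2_norm_eq_inner inner_diff_left inner_diff_right inner_add_right
            inner_commute algebra_simps)
  qed
  also have "\<dots> = exp (of_real (- pi * ((norm z2)\<^sup>2 + (norm w2)\<^sup>2)) + \<i> * of_real (2 * pi * (z1 \<bullet> z2 - w1 \<bullet> w2)))
      * ((of_real (sqrt pi) / csqrt a) ^ CARD('n)
         * exp ((of_real ((norm p)\<^sup>2 - (norm q)\<^sup>2) + 2 * \<i> * of_real (p \<bullet> q)) / (4 * a)))"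
    unfolding integral_mult_right_zero integral_gaussian[OF Re_a] by simp
  finally show ?thesis .
qed

lemma cmod_gabor_matrix_eq:
  fixes \<alpha> \<beta> t :: real and z1 z2 w1 w2 :: "real^'n"
  assumes "\<alpha> > 0" and "t > 0"
  defines "A \<equiv> 1 + 2 * pi * \<alpha> * t" and "B \<equiv> 2 * pi * \<beta> * t"
  shows "cmod (gabor_matrix \<alpha> \<beta> t (z1, z2) (w1, w2))
    = 1 / (2 powr (real CARD('n) / 2) * (A\<^sup>2 + B\<^sup>2) powr (real CARD('n) / 4))
      * exp (- pi * ((norm z2)\<^sup>2 + (norm w2)\<^sup>2)
          + pi / (2 * (A\<^sup>2 + B\<^sup>2)) * (A * ((norm (z2 + w2))\<^sup>2 - (norm (z1 - w1))\<^sup>2) - 2 * B * ((z2 + w2) \<bullet> (z1 - w1))))"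
proof -
  have "A > 0" using assms(1,2) by (simp add: A_def add_pos_pos)
  define D where "D = A\<^sup>2 + B\<^sup>2"
  have "D > 0" using \<open>A > 0\<close> by (simp add: D_def sum_power2_gt_zero_iff)
  define a where "a = 2 * of_real pi * Complex A B"
  have a_eq: "2 * of_real pi * Complex (1 + 2 * pi * \<alpha> * t) (2 * pi * \<beta> * t) = a"
    by (simp add: a_def A_def B_def)
  have Re_const: "Re (of_real x + \<i> * of_real y) = x" for x y by simp
  have cmod_a: "cmod a = 2 * pi * sqrt D"
    by (simp add: a_def norm_mult D_def complex_norm)
  have cmod_csqrt: "cmod (csqrt z) = sqrt (cmod z)" for z
    by (metis norm_power power2_csqrt real_sqrt_abs abs_norm_cancel)
  have amplitude: "cmod ((of_real (sqrt pi) / csqrt a) ^ CARD('n)) = 1 / (2 powr (real CARD('n) / 2) * D powr (real CARD('n) / 4))"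
  proof -
    have "cmod (of_real (sqrt pi) / csqrt a) = 1 / (2 powr (1/2) * D powr (1/4))"
      using \<open>D > 0\<close> by (simp add: norm_divide cmod_csqrt cmod_a real_sqrt_mult powr_half_sqrt[symmetric] powr_powr)
    then show ?thesis
      using \<open>D > 0\<close> unfolding norm_power
      by (simp only: power_divide power_mult_distrib) (simp add: powr_power)
  qed
  define P Q where "P = (2 * pi) *\<^sub>R (z2 + w2)" and "Q = (2 * pi) *\<^sub>R (w1 - z1)"
  have phase: "Re ((of_real ((norm P)\<^sup>2 - (norm Q)\<^sup>2) + 2 * \<i> * of_real (P \<bullet> Q)) / (4 * a))
     = pi / (2 * D) * (A * ((norm (z2 + w2))\<^sup>2 - (norm (z1 - w1))\<^sup>2) - 2 * B * ((z2 + w2) \<bullet> (z1 - w1)))"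
  proof -
    define N I where "N = (norm (z2 + w2))\<^sup>2 - (norm (z1 - w1))\<^sup>2" and "I = (z2 + w2) \<bullet> (z1 - w1)"
    have "(norm P)\<^sup>2 = 4 * pi\<^sup>2 * (norm (z2 + w2))\<^sup>2" "(norm Q)\<^sup>2 = 4 * pi\<^sup>2 * (norm (z1 - w1))\<^sup>2"
      by (simp_all add: P_def Q_def power_mult_distrib norm_minus_commute[of w1])
    then have "(norm P)\<^sup>2 - (norm Q)\<^sup>2 = 4 * pi\<^sup>2 * N"
      by (simp add: N_def right_diff_distrib)
    moreover have "P \<bullet> Q = - (4 * pi\<^sup>2 * I)"
      by (simp add: P_def Q_def I_def inner_diff_right power2_eq_square algebra_simps)
    moreover have "Re ((of_real (4 * pi\<^sup>2 * N) + 2 * \<i> * of_real (- (4 * pi\<^sup>2 * I))) / (4 * a)) = pi / (2 * D) * (A * N - 2 * B * I)"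
    proof -
      have "of_real (4 * pi\<^sup>2 * N) + 2 * \<i> * of_real (- (4 * pi\<^sup>2 * I))
          = of_real (8 * pi) * (of_real (pi / 2) * Complex N (- 2 * I))"
        by (simp add: complex_eq_iff power2_eq_square)
      moreover have "4 * a = of_real (8 * pi) * Complex A B"
        by (simp add: a_def complex_eq_iff)
      ultimately have "(of_real (4 * pi\<^sup>2 * N) + 2 * \<i> * of_real (- (4 * pi\<^sup>2 * I))) / (4 * a)
          = of_real (pi / 2) * (Complex N (- 2 * I) / Complex A B)"
        by simp
      also have "Re \<dots> = pi / (2 * D) * (A * N - 2 * B * I)"
      proof -
        have "Re (Complex N (- 2 * I) / Complex A B) = (A * N - 2 * B * I) / D"
          by (simp add: Re_divide D_def algebra_simps)
        moreover have "Re (of_real x * z) = x * Re z" for x z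
          by simp
        ultimately show ?thesis
          using \<open>D > 0\<close> by (simp only:) (simp add: field_simps)
      qed
      finally show ?thesis .
    qed
    ultimately show ?thesis by (simp only: N_def I_def)
  qed
  show ?thesis
    unfolding gabor_matrix_eq[OF assms(1,2)] a_eq P_def[symmetric] Q_def[symmetric]
      norm_mult amplitude norm_exp_eq_Re phase Re_const D_def[symmetric]
    by (simp only: exp_add mult_ac)
qed

section \<open>Comparison of the exponents\<close>

lemma quadratic_form_nonneg:
  fixes p q :: "'a::real_inner" and P Q R :: real
  assumes "P \<ge> 0" "Q \<ge> 0" "R\<^sup>2 \<le> P * Q"
  shows "0 \<le> P * (norm p)\<^sup>2 + Q * (norm q)\<^sup>2 + 2 * R * (p \<bullet> q)"
proof -
  have "\<bar>R\<bar> \<le> sqrt P * sqrt Q"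
    using assms(3) by (metis real_sqrt_abs real_sqrt_le_iff real_sqrt_mult)
  then have "\<bar>R * (p \<bullet> q)\<bar> \<le> (sqrt P * sqrt Q) * (norm p * norm q)"
    unfolding abs_mult using Cauchy_Schwarz_ineq2[of p q] assms by (intro mult_mono) auto
  moreover have "0 \<le> (sqrt P * norm p - sqrt Q * norm q)\<^sup>2" by simp
  ultimately show ?thesis
    using assms(1,2) by (simp add: power2_diff power_mult_distrib algebra_simps)
qed

text \<open>
  The number \<open>e\<close> is \<open>\<epsilon> / \<pi>\<close>. Everything rests on its quadratic equation \<open>(A - 1) / D = 2 e - 4 e\<^sup>2\<close> and
  on the bound \<open>2 e \<le> r = 1 / sqrt D\<close>. The latter comes from
  \<open>A \<le> sqrt D\<close>, which bounds the discriminant \<open>1 - 4 (A - 1) / D\<close> from below by the square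
  \<open>(1 - 2 r)\<^sup>2\<close> and so also shows that its square root is real. The determinant inequality cannot give
  the sign of \<open>1 - e/2 - A/D\<close> when \<open>A / D = 2 e\<close>, so that case uses \<open>e \<le> 1/4\<close>.
\<close>

lemma heat_eps_root_bounds:
  fixes A B :: real
  assumes A: "A > 1"
  defines "D \<equiv> A\<^sup>2 + B\<^sup>2"
  defines "e \<equiv> (1 - sqrt (1 - 4 * (A - 1) / D)) / 4"
  shows "0 \<le> e" "e \<le> 1 / 4" "2 * e \<le> A / D" "B\<^sup>2 / D\<^sup>2 \<le> (1 - e / 2 - A / D) * (A / D - 2 * e)"
    "0 \<le> 1 - e / 2 - A / D"
proof -
  define r where "r = 1 / sqrt D"
  have "D > 0" using A by (simp add: D_def add_pos_nonneg)
  have r: "r > 0" "r\<^sup>2 = 1 / D" using \<open>D > 0\<close> by (simp_all add: r_def power_divide)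
  have "A\<^sup>2 \<le> D" by (simp add: D_def)
  then have "A \<le> sqrt D" by (simp add: real_le_rsqrt)
  then have "A / D \<le> sqrt D / D" using \<open>D > 0\<close> by (intro divide_right_mono) auto
  also have "sqrt D / D = r" using \<open>D > 0\<close> by (simp add: r_def real_div_sqrt field_simps)
  finally have A_r: "A / D \<le> r" .
  define \<kappa> where "\<kappa> = (A - 1) / D"
  have \<kappa>: "\<kappa> = A / D - r\<^sup>2" "\<kappa> \<ge> 0" using A \<open>D > 0\<close> by (simp_all add: \<kappa>_def r diff_divide_distrib[symmetric])
  have square_le: "(1 - 2 * r)\<^sup>2 \<le> 1 - 4 * \<kappa>" using A_r 
  proof -
    have "(1 - 2 * r)\<^sup>2 = 1 - 4 * r + 4 * r\<^sup>2" by (simp add: power2_eq_square algebra_simps)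
    also have "\<dots> \<le> 1 - 4 * (x - r\<^sup>2)" if "x \<le> r" for x using that by simp
    note this[OF A_r]
    finally show ?thesis by (simp only: \<kappa>(1))
  qed
  define s where "s = sqrt (1 - 4 * \<kappa>)"
  have e_s: "e = (1 - s) / 4" by (simp add: e_def s_def \<kappa>_def)
  have s2: "s\<^sup>2 = 1 - 4 * \<kappa>" 
    using order_trans[OF zero_le_power2 square_le] by (simp add: s_def)
  have s: "s \<ge> 0" "s \<le> 1" "1 - 2 * r \<le> s"
    using square_le \<kappa>(2) order_trans[OF zero_le_power2 square_le] by (auto simp: s_def intro: real_le_rsqrt)
  show "0 \<le> e" "e \<le> 1 / 4" using s by (auto simp: e_s)
  have "\<kappa> = 2 * e - 4 * e\<^sup>2"
    using s2 by (simp add: e_s power2_eq_square field_simps)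
  then have AD: "A / D = 2 * e - 4 * e\<^sup>2 + r\<^sup>2" using \<kappa>(1) by simp
  have "2 * e \<le> r" using s by (simp add: e_s)
  then have "(2 * e)\<^sup>2 \<le> r\<^sup>2" using \<open>0 \<le> e\<close> by (intro power_mono) auto
  then show le: "2 * e \<le> A / D" using AD by (simp add: power_mult_distrib)
  have "(A / D)\<^sup>2 + B\<^sup>2 / D\<^sup>2 = r\<^sup>2"
    using \<open>D > 0\<close> by (simp add: r D_def[symmetric] power_divide add_divide_distrib[symmetric] power2_eq_square[of D])
  then have B: "B\<^sup>2 / D\<^sup>2 = (A / D - 2 * e + 4 * e\<^sup>2) - (A / D)\<^sup>2" using AD by simp
  have "(1 - e / 2 - A / D) * (A / D - 2 * e) - B\<^sup>2 / D\<^sup>2 = 3 / 2 * e * (A / D - 2 * e)"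
    unfolding B by (simp add: power2_eq_square algebra_simps)
  moreover have "0 \<le> 3 / 2 * e * (A / D - 2 * e)"
    using \<open>0 \<le> e\<close> le by simp
  ultimately show det: "B\<^sup>2 / D\<^sup>2 \<le> (1 - e / 2 - A / D) * (A / D - 2 * e)" by linarith
  show "0 \<le> 1 - e / 2 - A / D"
  proof (cases "A / D = 2 * e")
    case True
    then show ?thesis using \<open>e \<le> 1 / 4\<close> by simp
  next
    case False
    then have "0 < A / D - 2 * e" using le by simp
    moreover have "0 \<le> (1 - e / 2 - A / D) * (A / D - 2 * e)" using det by (rule order_trans[rotated]) simp
    ultimately show ?thesis by (simp add: zero_le_mult_iff)
  qed
qed

theorem proposition5p3:
  fixes \<alpha> \<beta> t :: real and z1 z2 w1 w2 :: "real^'n"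
  assumes "\<alpha> > 0" and "t > 0"
  shows "cmod (gabor_matrix \<alpha> \<beta> t (z1, z2) (w1, w2))
    \<le> 1 / (2 powr (real CARD('n) / 2)
            * ((1 + 2 * pi * \<alpha> * t)\<^sup>2 + (2 * pi * \<beta> * t)\<^sup>2) powr (real CARD('n) / 4))
      * exp (- (heat_eps t \<alpha> \<beta> / 2) * ((norm z2)\<^sup>2 + (norm w2)\<^sup>2)
             - heat_eps t \<alpha> \<beta> * (norm (z1 - w1))\<^sup>2)"
proof -
  define A B D where "A = 1 + 2 * pi * \<alpha> * t" and "B = 2 * pi * \<beta> * t" and "D = A\<^sup>2 + B\<^sup>2"
  define e where "e = (1 - sqrt (1 - 4 * (A - 1) / D)) / 4"
  have "A > 1" using assms by (simp add: A_def)
  note e = heat_eps_root_bounds[OF this, of B, folded D_def, folded e_def]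
  have eps: "heat_eps t \<alpha> \<beta> = pi * e"
    by (simp add: heat_eps_def e_def A_def B_def D_def)
  define p q m where "p = z2 + w2" and "q = z1 - w1" and "m = z2 - w2"
  \<comment> \<open>Apart from the sum of squares, both exponents depend on \<open>z2\<close> and \<open>w2\<close> through \<open>p\<close> at most, so that
      in the coordinates \<open>p\<close>, \<open>m\<close> the vector \<open>m\<close> decouples.\<close>
  have parallelogram: "(norm z2)\<^sup>2 + (norm w2)\<^sup>2 = ((norm p)\<^sup>2 + (norm m)\<^sup>2) / 2"
    by (simp add: p_def m_def power2_norm_eq_inner inner_diff_left inner_diff_right inner_add_left inner_add_right inner_commute)
  have "0 \<le> (1 - e / 2 - A / D) * (norm p)\<^sup>2 + (A / D - 2 * e) * (norm q)\<^sup>2 + 2 * (B / D) * (p \<bullet> q)"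
    using e by (intro quadratic_form_nonneg) (auto simp: power_divide)
  moreover have "0 \<le> (1 - e / 2) * (norm m)\<^sup>2" using e by simp
  ultimately have "0 \<le> pi / 2 * ((1 - e / 2 - A / D) * (norm p)\<^sup>2 + (A / D - 2 * e) * (norm q)\<^sup>2 + 2 * (B / D) * (p \<bullet> q)
      + (1 - e / 2) * (norm m)\<^sup>2)"
    by simp
  also have "\<dots> = (- (pi * e / 2) * ((norm z2)\<^sup>2 + (norm w2)\<^sup>2) - pi * e * (norm q)\<^sup>2)
      - (- pi * ((norm z2)\<^sup>2 + (norm w2)\<^sup>2)
          + pi / (2 * D) * (A * ((norm p)\<^sup>2 - (norm q)\<^sup>2) - 2 * B * (p \<bullet> q)))"
    unfolding parallelogram by (simp add: diff_divide_distrib algebra_simps)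
  finally have exponent: "- pi * ((norm z2)\<^sup>2 + (norm w2)\<^sup>2)
          + pi / (2 * D) * (A * ((norm p)\<^sup>2 - (norm q)\<^sup>2) - 2 * B * (p \<bullet> q))
      \<le> - (pi * e / 2) * ((norm z2)\<^sup>2 + (norm w2)\<^sup>2) - pi * e * (norm q)\<^sup>2"
    by simp
  show ?thesis
    unfolding cmod_gabor_matrix_eq[OF assms] eps
      A_def[symmetric] B_def[symmetric] D_def[symmetric] p_def[symmetric] q_def[symmetric]
    by (intro mult_left_mono exp_le_cancel_iff[THEN iffD2] exponent) simp
qed

end
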